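(* Let $\{X_n\}_{n\ge0}$ be a Markov chain with state space $\{1,2,3\}$ and transition matrix $P=[p_{ij}]$. The first passage time distribution $f_{12}^{(n)}=P\{T_{12}=n\}$ from state $1$ to state $2$ is given by $f_{12}^{(1)}=p_{12}$, $f_{12}^{(2)}=p_{11}p_{12}+p_{13}p_{32}$, and, for $n\ge2$, $$f_{12}^{(n)}=p_{12}b_{n-1}+(p_{13}p_{32}-p_{12}p_{33})b_{n-2},$$ where $b_0=1$, $b_1=p_{11}+p_{33}$, $b_2=p_{11}^2+p_{33}^2+p_{11}p_{33}+p_{13}p_{31}$, and, for $n\ge2$, $$b_n=(p_{11}+p_{33})b_{n-1}+(p_{13}p_{31}-p_{11}p_{33})b_{n-2}.$$
   Context: $T_{12}=\min\{n\ge1:X_n=2\}$ given $X_0=1$, so $f_{12}^{(n)}=P\{X_n=2,\ X_k\ne2\text{ for }k=1,\dots,n-1\mid X_0=1\}$. The sequence $(b_n)$ is determined by $b_0$, $b_1$ and the recurrence; the displayed value of $b_2$ is part of the assertion (it agrees with the recurrence). *)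

theory Defs
  imports "HOL-Probability.Probability"
begin

definition stochastic_matrix :: "real ^ 's::finite ^ 's \<Rightarrow> bool" where
  "stochastic_matrix P \<longleftrightarrow> (\<forall>i j. 0 \<le> P $ i $ j) \<and> (\<forall>i. (\<Sum>j\<in>UNIV. P $ i $ j) = 1)"

(* Time-homogeneous chain with an arbitrary initial distribution; the entry P $ i $ j is
   the probability of stepping from i to j. The Markov property is required only for
   histories of positive probability, since cond_prob is 0 on null conditions. *)
locale finite_markov_chain = prob_space M
  for M :: "'w measure" +
  fixes P :: "real ^ 's::finite ^ 's" and X :: "nat \<Rightarrow> 'w \<Rightarrow> 's"
  assumes stochastic: "stochastic_matrix P"
    and measurable_X: "\<And>n. X n \<in> measurable M (count_space UNIV)"
    and markov: "\<And>n x j. \<P>(\<omega> in M. \<forall>k\<le>n. X k \<omega> = x k) > 0 \<Longrightarrow>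
      \<P>(\<omega> in M. X (Suc n) \<omega> = j \<bar> \<forall>k\<le>n. X k \<omega> = x k) = P $ x n $ j"

(* The infimum in enat of the empty set is \<infinity>, so paths never visiting j get value \<infinity>. *)
definition first_passage_time :: "(nat \<Rightarrow> 'w \<Rightarrow> 's) \<Rightarrow> 's \<Rightarrow> 'w \<Rightarrow> enat" where
  "first_passage_time X j \<omega> = Inf {enat n | n. 1 \<le> n \<and> X n \<omega> = j}"

definition first_passage_prob ::
    "'w measure \<Rightarrow> (nat \<Rightarrow> 'w \<Rightarrow> 's) \<Rightarrow> 's \<Rightarrow> 's \<Rightarrow> nat \<Rightarrow> real" where
  "first_passage_prob M X i j n =
     \<P>(\<omega> in M. first_passage_time X j \<omega> = enat n \<bar> X 0 \<omega> = i)"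

lemma first_passage_time_eq_iff:
  "first_passage_time X j \<omega> = enat n \<longleftrightarrow>
     1 \<le> n \<and> X n \<omega> = j \<and> (\<forall>k\<in>{1..<n}. X k \<omega> \<noteq> j)"
proof -
  let ?A = "{enat n | n. 1 \<le> n \<and> X n \<omega> = j}"
  show ?thesis
  proof
    assume eq: "first_passage_time X j \<omega> = enat n"
    then have "?A \<noteq> {}"
      unfolding first_passage_time_def Inf_enat_def by (metis enat.distinct(1))
    then have "Inf ?A \<in> ?A"
      unfolding Inf_enat_def by (metis (mono_tags, lifting) LeastI_ex ex_in_conv)
    moreover have "enat n \<le> enat k" if "1 \<le> k" "X k \<omega> = j" for k
      using that eq unfolding first_passage_time_def by (metis (mono_tags, lifting) Inf_lower mem_Collect_eq)
    ultimately show "1 \<le> n \<and> X n \<omega> = j \<and> (\<forall>k\<in>{1..<n}. X k \<omega> \<noteq> j)"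
      using eq unfolding first_passage_time_def by fastforce
  next
    assume r: "1 \<le> n \<and> X n \<omega> = j \<and> (\<forall>k\<in>{1..<n}. X k \<omega> \<noteq> j)"
    show "first_passage_time X j \<omega> = enat n"
      unfolding first_passage_time_def
    proof (rule antisym)
      show "Inf ?A \<le> enat n" using r by (intro Inf_lower) auto
      show "enat n \<le> Inf ?A" using r by (intro Inf_greatest) (force simp: not_less)
    qed
  qed
qed

lemma first_passage_prob_eq:
  assumes "1 \<le> n"
  shows "first_passage_prob M X i j n =
    \<P>(\<omega> in M. X n \<omega> = j \<and> (\<forall>k\<in>{1..<n}. X k \<omega> \<noteq> j) \<bar> X 0 \<omega> = i)"
  using assms by (simp add: first_passage_prob_def first_passage_time_eq_iff)

end

theory Submission
  imports Defs
begin

text \<open>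
  Under the taboo of state 2, the pair of probabilities of being at 1 or at 3 evolves by the
  \<open>2 \<times> 2\<close> block of \<open>P\<close> with rows and columns 1, 3. That block has trace \<open>p\<^sub>1\<^sub>1 + p\<^sub>3\<^sub>3\<close> and determinant
  \<open>p\<^sub>1\<^sub>1 p\<^sub>3\<^sub>3 - p\<^sub>1\<^sub>3 p\<^sub>3\<^sub>1\<close>, so by Cayley--Hamilton its powers obey the recurrence of \<open>b\<close>; explicitly, the
  first row of its \<open>n\<close>-th power is \<open>(b\<^sub>n - p\<^sub>3\<^sub>3 b\<^sub>n\<^sub>-\<^sub>1, p\<^sub>1\<^sub>3 b\<^sub>n\<^sub>-\<^sub>1)\<close>. A last step into 2 gives the
  first passage probability.
\<close>

context finite_markov_chain
begin

declare measurable_X [measurable]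

text \<open>The Markov property in product form needs no positivity side condition: on a null
  history the left side vanishes by monotonicity.\<close>

lemma prob_path_Suc:
  "\<P>(\<omega> in M. (\<forall>k\<le>n. X k \<omega> = x k) \<and> X (Suc n) \<omega> = j) =
     \<P>(\<omega> in M. \<forall>k\<le>n. X k \<omega> = x k) * P $ x n $ j"
proof (cases "\<P>(\<omega> in M. \<forall>k\<le>n. X k \<omega> = x k) > 0")
  case True
  with markov[OF True, of j] show ?thesis
    by (simp add: cond_prob_def field_simps conj_commute)
next
  case False
  then have null: "\<P>(\<omega> in M. \<forall>k\<le>n. X k \<omega> = x k) = 0"
    by (simp add: zero_less_measure_iff)
  have "\<P>(\<omega> in M. (\<forall>k\<le>n. X k \<omega> = x k) \<and> X (Suc n) \<omega> = j)
      \<le> \<P>(\<omega> in M. \<forall>k\<le>n. X k \<omega> = x k)"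
    by (intro finite_measure_mono) auto
  with null show ?thesis
    by (simp add: measure_le_0_iff)
qed

text \<open>The history event is a finite disjoint union of single paths. Each of them ends in
  \<open>i\<close>, so \<open>prob_path_Suc\<close> gives every summand the same factor
  \<open>P $ i $ j\<close>, which comes out of the sum.\<close>

lemma prob_history_Suc:
  fixes A :: "nat \<Rightarrow> 's set"
  shows "\<P>(\<omega> in M. (\<forall>k\<le>n. X k \<omega> \<in> A k) \<and> X n \<omega> = i \<and> X (Suc n) \<omega> = j) =
     \<P>(\<omega> in M. (\<forall>k\<le>n. X k \<omega> \<in> A k) \<and> X n \<omega> = i) * P $ i $ j"
proof -
  \<comment> \<open>Extensional functions have a fixed value beyond \<open>n\<close>, so each
    history corresponds to exactly one element of \<open>S\<close>.\<close>
  define S where "S = {x \<in> PiE {..n} A. x n = i}"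
  have fin: "finite S"
    unfolding S_def by (intro finite_subset[OF _ finite_PiE[of "{..n}" A]]) auto
  have path: "\<exists>!x. x \<in> S \<and> (\<forall>k\<le>n. X k \<omega> = x k)"
    if "\<forall>k\<le>n. X k \<omega> \<in> A k" "X n \<omega> = i" for \<omega>
  proof (rule ex1I[of _ "restrict (\<lambda>k. X k \<omega>) {..n}"])
    fix x assume x: "x \<in> S \<and> (\<forall>k\<le>n. X k \<omega> = x k)"
    then have "x \<in> extensional {..n}"
      by (auto simp: S_def PiE_def)
    then show "x = restrict (\<lambda>k. X k \<omega>) {..n}"
      using x by (intro extensionalityI[of _ "{..n}"]) auto
  qed (use that in \<open>auto simp: S_def\<close>)
  have inS: "(\<forall>k\<le>n. X k \<omega> \<in> A k) \<and> X n \<omega> = i" if "x \<in> S" "\<forall>k\<le>n. X k \<omega> = x k" for x \<omega>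
    using that by (auto simp: S_def PiE_iff)
  \<comment> \<open>The extra event \<open>E\<close> lets one decomposition serve twice: with the
    next step to \<open>j\<close>, and with \<open>True\<close> to reassemble the history.\<close>
  have decompose: "\<P>(\<omega> in M. (\<forall>k\<le>n. X k \<omega> \<in> A k) \<and> X n \<omega> = i \<and> E \<omega>) =
      (\<Sum>x\<in>S. \<P>(\<omega> in M. (\<forall>k\<le>n. X k \<omega> = x k) \<and> E \<omega>))"
    if [measurable]: "Measurable.pred M E" for E
  proof (rule prob_sum[where P = "\<lambda>x \<omega>. (\<forall>k\<le>n. X k \<omega> = x k) \<and> E \<omega>"
        and Q = "\<lambda>\<omega>. (\<forall>k\<le>n. X k \<omega> \<in> A k) \<and> X n \<omega> = i \<and> E \<omega>"])
    show "AE \<omega> in M.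
        (\<forall>x\<in>S. (\<forall>k\<le>n. X k \<omega> = x k) \<and> E \<omega> \<longrightarrow>
          (\<forall>k\<le>n. X k \<omega> \<in> A k) \<and> X n \<omega> = i \<and> E \<omega>) \<and>
        ((\<forall>k\<le>n. X k \<omega> \<in> A k) \<and> X n \<omega> = i \<and> E \<omega> \<longrightarrow>
          (\<exists>!x. x \<in> S \<and> (\<forall>k\<le>n. X k \<omega> = x k) \<and> E \<omega>))"
    proof (intro AE_I2 conjI ballI impI)
      fix \<omega> assume "(\<forall>k\<le>n. X k \<omega> \<in> A k) \<and> X n \<omega> = i \<and> E \<omega>"
      with path[of \<omega>] show "\<exists>!x. x \<in> S \<and> (\<forall>k\<le>n. X k \<omega> = x k) \<and> E \<omega>"
        by simp
    qed (use inS in blast)+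
  qed (use fin in measurable)
  have "\<P>(\<omega> in M. (\<forall>k\<le>n. X k \<omega> \<in> A k) \<and> X n \<omega> = i \<and> X (Suc n) \<omega> = j) =
      (\<Sum>x\<in>S. \<P>(\<omega> in M. (\<forall>k\<le>n. X k \<omega> = x k) \<and> X (Suc n) \<omega> = j))"
    by (rule decompose) measurable
  also have "\<dots> = (\<Sum>x\<in>S. \<P>(\<omega> in M. \<forall>k\<le>n. X k \<omega> = x k) * P $ i $ j)"
    by (intro sum.cong) (auto simp: prob_path_Suc S_def)
  also have "\<dots> = (\<Sum>x\<in>S. \<P>(\<omega> in M. \<forall>k\<le>n. X k \<omega> = x k)) * P $ i $ j"
    by (simp add: sum_distrib_right)
  also have "(\<Sum>x\<in>S. \<P>(\<omega> in M. \<forall>k\<le>n. X k \<omega> = x k)) =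
      \<P>(\<omega> in M. (\<forall>k\<le>n. X k \<omega> \<in> A k) \<and> X n \<omega> = i)"
    using decompose[of "\<lambda>_. True"] by simp
  finally show ?thesis .
qed

text \<open>A joint rather than conditional probability, so that \<open>prob_history_Suc\<close>
  applies directly and normalization waits until the end. The taboo starts at time 1, leaving the
  initial state free.\<close>

definition taboo_prob :: "'s \<Rightarrow> 's \<Rightarrow> nat \<Rightarrow> 's \<Rightarrow> real" where
  "taboo_prob i j n l =
     \<P>(\<omega> in M. X 0 \<omega> = i \<and> (\<forall>k\<in>{1..n}. X k \<omega> \<noteq> j) \<and> X n \<omega> = l)"

lemma taboo_prob_0: "taboo_prob i j 0 l = (if l = i then \<P>(\<omega> in M. X 0 \<omega> = i) else 0)"
proof (cases "l = i")
  case False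
  then have "{\<omega> \<in> space M. X 0 \<omega> = i \<and> X 0 \<omega> = l} = {}"
    by auto
  with False show ?thesis
    by (simp add: taboo_prob_def del: Collect_empty_eq)
qed (simp add: taboo_prob_def)

text \<open>Split by the state at time \<open>n\<close>. The target \<open>m\<close> is
  unrestricted: \<open>m = j\<close> yields the first passage, any other \<open>m\<close> the taboo
  recursion.\<close>

lemma taboo_step:
  "\<P>(\<omega> in M. X 0 \<omega> = i \<and> (\<forall>k\<in>{1..n}. X k \<omega> \<noteq> j) \<and> X (Suc n) \<omega> = m) =
     (\<Sum>l\<in>UNIV. taboo_prob i j n l * P $ l $ m)"
proof -
  \<comment> \<open>The start and the taboo together form one set-valued history, even when
    \<open>i = j\<close>.\<close>
  define A where "A k = (if k = 0 then {i} else - {j})" for k :: nat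
  have A: "(\<forall>k\<le>n. X k \<omega> \<in> A k) \<longleftrightarrow> X 0 \<omega> = i \<and> (\<forall>k\<in>{1..n}. X k \<omega> \<noteq> j)" for \<omega>
  proof -
    have "{..n} = insert 0 {1..n}"
      by auto
    then have "(\<forall>k\<in>{..n}. X k \<omega> \<in> A k) \<longleftrightarrow> X 0 \<omega> \<in> A 0 \<and> (\<forall>k\<in>{1..n}. X k \<omega> \<in> A k)"
      by (simp only:) blast
    also have "\<dots> \<longleftrightarrow> X 0 \<omega> = i \<and> (\<forall>k\<in>{1..n}. X k \<omega> \<noteq> j)"
      by (simp add: A_def)
    finally show ?thesis
      by (simp add: Ball_def)
  qed
  have "\<P>(\<omega> in M. X 0 \<omega> = i \<and> (\<forall>k\<in>{1..n}. X k \<omega> \<noteq> j) \<and> X (Suc n) \<omega> = m) =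
      (\<Sum>l\<in>UNIV. \<P>(\<omega> in M. (\<forall>k\<le>n. X k \<omega> \<in> A k) \<and> X n \<omega> = l \<and> X (Suc n) \<omega> = m))"
    by (rule prob_sum) (auto simp: A)
  also have "\<dots> = (\<Sum>l\<in>UNIV. taboo_prob i j n l * P $ l $ m)"
    unfolding prob_history_Suc by (simp add: taboo_prob_def A conj_assoc)
  finally show ?thesis .
qed

lemma taboo_prob_Suc:
  assumes "m \<noteq> j"
  shows "taboo_prob i j (Suc n) m = (\<Sum>l\<in>UNIV. taboo_prob i j n l * P $ l $ m)"
  unfolding taboo_step[symmetric] unfolding taboo_prob_def
  using assms by (intro arg_cong[where f = prob]) (auto simp: atLeastAtMostSuc_conv)

lemma taboo_prob_Suc_self: "taboo_prob i j (Suc n) j = 0"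
proof -
  have "{\<omega> \<in> space M. X 0 \<omega> = i \<and> (\<forall>k\<in>{1..Suc n}. X k \<omega> \<noteq> j) \<and> X (Suc n) \<omega> = j} = {}"
    by auto
  then show ?thesis
    unfolding taboo_prob_def by (simp only: measure_empty)
qed

text \<open>First passage at \<open>Suc n\<close> is a taboo path up to \<open>n\<close> followed by
  a step into \<open>j\<close>. For a null start both sides are 0, by division by zero.\<close>

lemma first_passage_prob_Suc:
  "first_passage_prob M X i j (Suc n) =
     (\<Sum>l\<in>UNIV. taboo_prob i j n l * P $ l $ j) / \<P>(\<omega> in M. X 0 \<omega> = i)"
  unfolding taboo_step[symmetric]
  by (simp add: first_passage_prob_eq cond_prob_def atLeastLessThanSuc_atLeastAtMost conj_ac)

end

theorem corollary4p4:
  fixes M :: "'w measure" and P :: "real ^ 3 ^ 3" and X :: "nat \<Rightarrow> 'w \<Rightarrow> 3"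
    and b :: "nat \<Rightarrow> real"
  assumes "finite_markov_chain M P X"
    and "\<P>(\<omega> in M. X 0 \<omega> = 1) > 0"
    and "b 0 = 1"
    and "b 1 = P $ 1 $ 1 + P $ 3 $ 3"
    and "\<And>n. n \<ge> 2 \<Longrightarrow> b n = (P $ 1 $ 1 + P $ 3 $ 3) * b (n - 1)
           + (P $ 1 $ 3 * P $ 3 $ 1 - P $ 1 $ 1 * P $ 3 $ 3) * b (n - 2)"
  shows "first_passage_prob M X 1 2 1 = P $ 1 $ 2
    \<and> first_passage_prob M X 1 2 2 = P $ 1 $ 1 * P $ 1 $ 2 + P $ 1 $ 3 * P $ 3 $ 2
    \<and> b 2 = (P $ 1 $ 1)\<^sup>2 + (P $ 3 $ 3)\<^sup>2 + P $ 1 $ 1 * P $ 3 $ 3 + P $ 1 $ 3 * P $ 3 $ 1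
    \<and> (\<forall>n\<ge>2. first_passage_prob M X 1 2 n = P $ 1 $ 2 * b (n - 1)
           + (P $ 1 $ 3 * P $ 3 $ 2 - P $ 1 $ 2 * P $ 3 $ 3) * b (n - 2))"
proof -
  interpret finite_markov_chain M P X by fact
  define q where "q = \<P>(\<omega> in M. X 0 \<omega> = 1)"
  have q: "q > 0"
    using assms(2) by (simp add: q_def)
  define u where "u = taboo_prob 1 2"
  note rec = assms(5)
  have u0: "u 0 1 = q" "u 0 2 = 0" "u 0 3 = 0"
    by (simp_all add: u_def taboo_prob_0 q_def)
  \<comment> \<open>State 2 carries no mass: at time 0 because the chain starts in 1, later because
    of the taboo. Sums over the three states thus reduce to 1 and 3.\<close>
  have u2: "u n 2 = 0" for n
    by (cases n) (simp_all add: u0, simp add: u_def taboo_prob_Suc_self)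
  have u1_Suc: "u (Suc n) 1 = u n 1 * P $ 1 $ 1 + u n 3 * P $ 3 $ 1" for n
    using taboo_prob_Suc[of 1 2 1 n] u2[of n] by (simp add: u_def sum_3)
  have u3_Suc: "u (Suc n) 3 = u n 1 * P $ 1 $ 3 + u n 3 * P $ 3 $ 3" for n
    using taboo_prob_Suc[of 3 2 1 n] u2[of n] by (simp add: u_def sum_3)
  have f: "first_passage_prob M X 1 2 (Suc n) = (u n 1 * P $ 1 $ 2 + u n 3 * P $ 3 $ 2) / q" for n
    using u2[of n] by (simp add: first_passage_prob_Suc u_def q_def sum_3)
  \<comment> \<open>Stated from time 1 on, since the formula would need an index -1 for
    \<open>b\<close> at time 0. In the step for state 1, the terms
    \<open>P $ 1 $ 1 * (b (Suc n) - P $ 3 $ 3 * b n)\<close> and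
    \<open>P $ 1 $ 3 * P $ 3 $ 1 * b n\<close> combine by the recurrence.\<close>
  have u: "u (Suc n) 1 = q * (b (Suc n) - P $ 3 $ 3 * b n) \<and> u (Suc n) 3 = q * (P $ 1 $ 3 * b n)" for n
  proof (induction n)
    case 0
    show ?case
      using u1_Suc[of 0] u3_Suc[of 0] assms(3,4) by (simp add: u0)
  next
    case (Suc n)
    have "b (Suc (Suc n)) = (P $ 1 $ 1 + P $ 3 $ 3) * b (Suc n)
        + (P $ 1 $ 3 * P $ 3 $ 1 - P $ 1 $ 1 * P $ 3 $ 3) * b n"
      using rec[of "Suc (Suc n)"] by simp
    then show ?case
      by (simp add: Suc.IH u1_Suc[of "Suc n"] u3_Suc[of "Suc n"]) (simp add: algebra_simps)
  qed
  \<comment> \<open>Passage at time \<open>n + 2\<close> uses the taboo masses at time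
    \<open>n + 1\<close>; their common factor \<open>q\<close> cancels.\<close>
  have f_Suc_Suc: "first_passage_prob M X 1 2 (Suc (Suc n)) = P $ 1 $ 2 * b (Suc n)
      + (P $ 1 $ 3 * P $ 3 $ 2 - P $ 1 $ 2 * P $ 3 $ 3) * b n" for n
    using q by (simp add: f u) (simp add: field_simps)
  have "first_passage_prob M X 1 2 1 = P $ 1 $ 2"
    using f[of 0] q by (simp add: u0)
  moreover have "first_passage_prob M X 1 2 2 = P $ 1 $ 1 * P $ 1 $ 2 + P $ 1 $ 3 * P $ 3 $ 2"
    \<comment> \<open>With \<open>b 1\<close> inserted, the two terms
      \<open>P $ 1 $ 2 * P $ 3 $ 3\<close> cancel.\<close>
    using f_Suc_Suc[of 0] assms(3,4) by (simp add: numeral_2_eq_2 algebra_simps)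
  moreover have "b 2 = (P $ 1 $ 1)\<^sup>2 + (P $ 3 $ 3)\<^sup>2 + P $ 1 $ 1 * P $ 3 $ 3 + P $ 1 $ 3 * P $ 3 $ 1"
    using rec[of 2] assms(3,4) by (simp add: power2_eq_square algebra_simps)
  moreover have "first_passage_prob M X 1 2 n = P $ 1 $ 2 * b (n - 1)
      + (P $ 1 $ 3 * P $ 3 $ 2 - P $ 1 $ 2 * P $ 3 $ 3) * b (n - 2)" if n: "n \<ge> 2" for n
  proof -
    obtain m where "n = Suc (Suc m)"
      using le_Suc_ex[OF n] by auto
    then show ?thesis
      using f_Suc_Suc[of m] by simp
  qed
  ultimately show ?thesis
    by blast
qed

end
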